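(* Let $f\in L^\infty(\mathbb{R}_+)$, let $z_p:(-\infty,0)\to\mathbb{R}$ be Lipschitz continuous, and let $\varrho:\mathbb{R}_+\to\mathbb{R}_+$ be a Lipschitz continuous function such that $\int_0^\infty \varrho(a)\,da=1$, $\int_0^\infty (1+a)^2\varrho(a)\,da<\infty$, $\partial_a\varrho(a)\le 0$, and such that there is a constant $\zeta>0$ with $-\partial_a\varrho(a)/\varrho(a)\le\zeta$ for all $a>0$. Assume that $z\in L^1_{\mathrm{loc}}(\mathbb{R}_+)$ solves $$\int_0^\infty \bigl(z(t)-z(t-a)\bigr)\varrho(a)\,da=f(t)\quad (t>0),\qquad z(t)=z_p(t)\quad (t<0).$$ Then $z\in L^\infty(0,T)$ for every finite $T>0$.
   Context: $\mathbb{R}_+=[0,\infty)$. The derivative $\partial_a\varrho$ of the Lipschitz function $\varrho$ exists almost everywhere, and pointwise conditions on it are understood for almost every $a$. The condition $-\partial_a\varrho/\varrho\le\zeta$ presupposes $\varrho>0$. The equation for $z$ is understood for almost every $t>0$. *)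

theory Defs
  imports "HOL-Analysis.Analysis"
begin

definition Linfty :: "real set \<Rightarrow> (real \<Rightarrow> real) set" where
  "Linfty S = {f \<in> borel_measurable (lebesgue_on S). \<exists>C. AE x in lebesgue_on S. \<bar>f x\<bar> \<le> C}"

text \<open>The compact sets \<open>K\<close> range over subsets of \<open>S\<close> itself, so for \<open>S = {0..}\<close> a function in
  \<open>L1loc S\<close> is integrable up to the endpoint 0.\<close>

definition L1loc :: "real set \<Rightarrow> (real \<Rightarrow> real) set" where
  "L1loc S = {f. \<forall>K. compact K \<longrightarrow> K \<subseteq> S \<longrightarrow> integrable (lebesgue_on K) f}"

text \<open>The function \<open>z\<close> is given on the whole line as a representative, with the past data built in on
  the negative half-line. If \<open>z\<close> is in \<open>L1loc {0..}\<close>, \<open>zp\<close> is Lipschitz and \<open>\<rho>\<close> is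
  Lipschitz with finite first moment, then the integrand is integrable for every \<open>t > 0\<close>, so
  the Bochner integral never takes its default value.\<close>

definition solves_delay_equation ::
  "(real \<Rightarrow> real) \<Rightarrow> (real \<Rightarrow> real) \<Rightarrow> (real \<Rightarrow> real) \<Rightarrow> (real \<Rightarrow> real) \<Rightarrow> bool" where
  "solves_delay_equation \<rho> f zp z \<longleftrightarrow>
     (AE t in lebesgue_on {0<..}.
        (LINT a|lebesgue_on {0..}. (z t - z (t - a)) * \<rho> a) = f t) \<and>
     (\<forall>t<0. z t = zp t)"

end

theory Submission imports Defs begin

text \<open>Since \<open>\<rho>\<close> has unit mass, the equation reads
  \<open>z t = f t + (\<integral>a\<ge>0. z (t - a) * \<rho> a)\<close> for almost every \<open>t > 0\<close>. For \<open>t < T\<close> the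
  part \<open>a \<le> t\<close> of the integral is at most \<open>sup\<^bsub>[0,T]\<^esub> \<rho>\<close> times the \<open>L\<^sup>1\<close> norm of \<open>z\<close> on
  \<open>(0,T)\<close>, and the part \<open>a > t\<close> is controlled by the linear growth of \<open>zp\<close> and the moments of
  \<open>\<rho>\<close>.\<close>

text \<open>Comparison with one reference point suffices. The bound is global, whereas
  \<open>zp\<close> is evaluated at arbitrarily negative times \<open>t - a\<close>.\<close>

lemma lipschitz_on_linear_growth:
  fixes g :: "real \<Rightarrow> real"
  assumes "L-lipschitz_on S g"
  obtains C where "C \<ge> 0" "\<And>s. s \<in> S \<Longrightarrow> \<bar>g s\<bar> \<le> C * (1 + \<bar>s\<bar>)"
proof (cases "S = {}")
  case True
  then show ?thesis using that[of 0] by simp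
next
  case False
  then obtain r where r: "r \<in> S" by blast
  \<comment> \<open>Expanding \<open>C * (1 + \<bar>s\<bar>)\<close> gives the triangle bound
    through \<open>r\<close>, plus nonnegative surplus terms.\<close>
  define C where "C = \<bar>g r\<bar> + L * (1 + \<bar>r\<bar>)"
  have L: "L \<ge> 0" using assms lipschitz_on_nonneg by blast
  show ?thesis
  proof (rule that)
    show "C \<ge> 0" using L by (simp add: C_def)
    fix s assume s: "s \<in> S"
    have "\<bar>g s\<bar> \<le> \<bar>g r\<bar> + \<bar>g s - g r\<bar>" by simp
    also have "\<bar>g s - g r\<bar> \<le> L * \<bar>s - r\<bar>"
      using lipschitz_onD[OF assms s r] by (simp add: dist_real_def)
    also have "L * \<bar>s - r\<bar> \<le> L * (\<bar>s\<bar> + \<bar>r\<bar>)" using L by (intro mult_left_mono) auto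
    also have "\<bar>g r\<bar> + L * (\<bar>s\<bar> + \<bar>r\<bar>) \<le> C * (1 + \<bar>s\<bar>)"
    proof -
      have "0 \<le> \<bar>g r\<bar> * \<bar>s\<bar>" "0 \<le> L * (\<bar>r\<bar> * \<bar>s\<bar>)" using L by auto
      then show ?thesis using L by (simp add: C_def algebra_simps)
    qed
    finally show "\<bar>g s\<bar> \<le> C * (1 + \<bar>s\<bar>)" by simp
  qed
qed

text \<open>The integrand is dominated by a function whose integral does not depend on
  \<open>t\<close>, which makes the bound uniform on \<open>{0..T}\<close>. Integrability is stated
  too: the equation can be split into two integrals only if neither is a default value.\<close>

lemma delayed_average_bound:
  fixes w k :: "real \<Rightarrow> real"
  assumes w: "(\<lambda>s. indicator {..T} s * w s) \<in> borel_measurable lebesgue"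
    and wint: "integrable (lebesgue_on {0..T}) w"
    and past: "\<And>s. s < 0 \<Longrightarrow> \<bar>w s\<bar> \<le> C * (1 + \<bar>s\<bar>)" and C: "C \<ge> 0"
    and k: "k \<in> borel_measurable (lebesgue_on {0..})"
    and k0: "\<And>a. a \<ge> 0 \<Longrightarrow> k a \<ge> 0" and kM: "\<And>a. a \<in> {0..T} \<Longrightarrow> k a \<le> M"
    and moment: "integrable (lebesgue_on {0..}) (\<lambda>a. (1 + a)^2 * k a)"
    and t: "t \<in> {0..T}"
  shows "integrable (lebesgue_on {0..}) (\<lambda>a. w (t - a) * k a)"
    and "\<bar>LINT a|lebesgue_on {0..}. w (t - a) * k a\<bar>
      \<le> M * (LINT s|lebesgue_on {0..T}. \<bar>w s\<bar>) + C * (LINT a|lebesgue_on {0..}. (1 + a)^2 * k a)"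
proof -
  \<comment> \<open>All functions are extended by zero to the whole line, so that the reflection
    \<open>a\<close> to \<open>t - a\<close> acts on plain Lebesgue measure. \<open>D\<close> is the
    dominating function for \<open>h\<close>.\<close>
  define g where "g = (\<lambda>s. indicator {0..T} s * \<bar>w s\<bar>)"
  define m where "m = (\<lambda>a. indicator {0..} a * ((1 + a)^2 * k a))"
  define h where "h = (\<lambda>a. indicator {0..} a * (w (t - a) * k a))"
  define D where "D = (\<lambda>a. M * g (t - a) + C * m a)"
  have M: "M \<ge> 0" using k0[of t] kM[of t] t by auto
  have gint: "integrable lebesgue g"
    using integrable_abs[OF wint] by (simp add: integrable_restrict_space g_def)
  have g_eq: "(LINT s|lebesgue. g s) = (LINT s|lebesgue_on {0..T}. \<bar>w s\<bar>)"
    by (simp add: integral_restrict_space g_def)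
  \<comment> \<open>An affine map of slope -1 preserves integrals, so the dependence on
    \<open>t\<close> disappears.\<close>
  have gint': "integrable lebesgue (\<lambda>a. g (t - a))"
    using lebesgue_integrable_real_affine[OF gint, of "-1" t] by simp
  have g_eq': "(LINT a|lebesgue. g (t - a)) = (LINT s|lebesgue_on {0..T}. \<bar>w s\<bar>)"
    using lebesgue_integral_real_affine[of "-1" g t] g_eq by simp
  have mint: "integrable lebesgue m"
    using moment by (simp add: integrable_restrict_space m_def)
  have m_eq: "(LINT a|lebesgue. m a) = (LINT a|lebesgue_on {0..}. (1 + a)^2 * k a)"
    by (simp add: integral_restrict_space m_def)
  have Dint: "integrable lebesgue D" unfolding D_def using gint' mint by simp
  have D_eq: "(LINT a|lebesgue. D a) = M * (LINT s|lebesgue_on {0..T}. \<bar>w s\<bar>)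
      + C * (LINT a|lebesgue_on {0..}. (1 + a)^2 * k a)"
    unfolding D_def using gint' mint g_eq' m_eq by simp
  have hD: "\<bar>h a\<bar> \<le> D a" for a
  proof -
    \<comment> \<open>For \<open>a < 0\<close> the integrand vanishes; for
      \<open>0 \<le> a \<le> t\<close> the term with \<open>g\<close> dominates; for
      \<open>t < a\<close> the delayed time is negative, \<open>g\<close> vanishes there and the
      term with \<open>m\<close> dominates.\<close>
    consider "a < 0" | "0 \<le> a" "a \<le> t" | "t < a" by linarith
    then show ?thesis
    proof cases
      case 1
      then show ?thesis using M by (simp add: h_def D_def m_def g_def)
    next
      case 2
      have "\<bar>w (t - a)\<bar> * k a \<le> \<bar>w (t - a)\<bar> * M" using 2 t by (intro mult_left_mono kM) auto
      moreover have "0 \<le> C * ((1 + a)^2 * k a)" using C k0 2 by simp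
      ultimately show ?thesis using 2 t k0[of a]
        by (simp add: h_def D_def m_def g_def abs_mult mult.commute)
    next
      case 3
      have a: "a \<ge> 0" using 3 t by simp
      have "\<bar>w (t - a)\<bar> \<le> C * (1 + \<bar>t - a\<bar>)" using 3 by (intro past) simp
      also have "\<dots> \<le> C * (1 + a)" using 3 t C by (intro mult_left_mono) auto
      \<comment> \<open>Since \<open>1 + a \<ge> 1\<close>, the linear growth is absorbed by the
        quadratic moment weight.\<close>
      also have "\<dots> \<le> C * (1 + a)^2"
        using a C self_le_power[of "1 + a" 2] by (intro mult_left_mono) auto
      finally have "\<bar>w (t - a)\<bar> * k a \<le> C * (1 + a)^2 * k a"
        using k0[OF a] by (rule mult_right_mono)
      then show ?thesis using 3 a M k0[OF a]
        by (simp add: h_def D_def m_def g_def abs_mult mult.assoc)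
    qed
  qed
  have hmeas: "h \<in> borel_measurable lebesgue"
  proof -
    \<comment> \<open>The cutoff at \<open>T\<close> is invisible in \<open>h\<close>: for
      \<open>a \<ge> 0\<close> the argument \<open>t - a\<close> never exceeds
      \<open>t \<le> T\<close>.\<close>
    define v where "v s = indicator {..T} s * w s" for s
    have "(\<lambda>a. t + (-1) * a) \<in> lebesgue \<rightarrow>\<^sub>M lebesgue"
      using lebesgue_affine_measurable[where c = "\<lambda>x::real. -1" and t = t] by simp
    then have "(\<lambda>a. v (t - a)) \<in> borel_measurable lebesgue"
      using measurable_compose w unfolding v_def by fastforce
    moreover have "(\<lambda>a. indicator {0..} a * k a) \<in> borel_measurable lebesgue"
      using k by (simp add: borel_measurable_restrict_space_iff mult.commute)
    moreover have "h = (\<lambda>a. v (t - a) * (indicator {0..} a * k a))"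
      using t by (auto simp: h_def v_def indicator_def fun_eq_iff)
    ultimately show ?thesis by simp
  qed
  have hint: "integrable lebesgue h"
    using hD by (intro Bochner_Integration.integrable_bound[OF Dint hmeas]) (auto intro!: AE_I2 intro: order_trans[OF _ abs_ge_self])
  then show "integrable (lebesgue_on {0..}) (\<lambda>a. w (t - a) * k a)"
    by (simp add: integrable_restrict_space h_def)
  have "\<bar>LINT a|lebesgue. h a\<bar> \<le> (LINT a|lebesgue. \<bar>h a\<bar>)"
    by (rule integral_abs_bound)
  also have "\<dots> \<le> (LINT a|lebesgue. D a)"
    using hint Dint hD by (intro integral_mono) auto
  finally show "\<bar>LINT a|lebesgue_on {0..}. w (t - a) * k a\<bar>
      \<le> M * (LINT s|lebesgue_on {0..T}. \<bar>w s\<bar>) + C * (LINT a|lebesgue_on {0..}. (1 + a)^2 * k a)"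
    by (simp add: integral_restrict_space h_def D_eq)
qed

theorem theorem1:
  fixes f zp \<rho> z :: "real \<Rightarrow> real" and \<zeta> :: real
  assumes "f \<in> Linfty {0..}"
    and "\<exists>L. L-lipschitz_on {..<0} zp"
    and "\<exists>L. L-lipschitz_on {0..} \<rho>"
    and "\<And>a. a \<ge> 0 \<Longrightarrow> \<rho> a \<ge> 0"
    and "(LINT a|lebesgue_on {0..}. \<rho> a) = 1"
    and "integrable (lebesgue_on {0..}) (\<lambda>a. (1 + a)^2 * \<rho> a)"
    and "AE a in lebesgue_on {0<..}. deriv \<rho> a \<le> 0"
    and "\<zeta> > 0"
    and "\<And>a. a > 0 \<Longrightarrow> \<rho> a > 0"
    and "AE a in lebesgue_on {0<..}. - deriv \<rho> a / \<rho> a \<le> \<zeta>"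
    and "z \<in> L1loc {0..}"
    and "solves_delay_equation \<rho> f zp z"
  shows "\<forall>T>0. z \<in> Linfty {0<..<T}"
proof (intro allI impI)
  fix T :: real
  assume T: "T > 0"
  obtain L where L: "L-lipschitz_on {..<0} zp" using assms(2) by blast
  obtain C where C: "C \<ge> 0" and zpC: "\<And>s. s < 0 \<Longrightarrow> \<bar>zp s\<bar> \<le> C * (1 + \<bar>s\<bar>)"
    using lipschitz_on_linear_growth[OF L] by auto
  have zzp: "z s = zp s" if "s < 0" for s
    using assms(12) that by (auto simp: solves_delay_equation_def)
  have eqn: "AE t in lebesgue_on {0<..}. (LINT a|lebesgue_on {0..}. (z t - z (t - a)) * \<rho> a) = f t"
    using assms(12) by (simp add: solves_delay_equation_def)
  obtain B where fB: "AE t in lebesgue_on {0..}. \<bar>f t\<bar> \<le> B"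
    using assms(1) by (auto simp: Linfty_def)
  have \<rho>cont: "continuous_on {0..} \<rho>" using assms(3) lipschitz_on_continuous_on by blast
  have "bounded (\<rho> ` {0..T})"
    by (intro compact_imp_bounded compact_continuous_image continuous_on_subset[OF \<rho>cont]) auto
  then obtain M where M: "\<And>a. a \<in> {0..T} \<Longrightarrow> \<rho> a \<le> M"
    unfolding bounded_iff by (force dest: abs_le_D1)
  have \<rho>meas: "\<rho> \<in> borel_measurable (lebesgue_on {0..})"
    using \<rho>cont by (intro continuous_imp_measurable_on_sets_lebesgue) auto
  \<comment> \<open>A non-integrable function would have Bochner integral 0, not 1.\<close>
  have \<rho>int: "integrable (lebesgue_on {0..}) \<rho>"
    using assms(5) not_integrable_integral_eq by fastforce
  have zint: "integrable (lebesgue_on {0..T}) z"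
    using assms(11) by (auto simp: L1loc_def)
  have zmeas: "(\<lambda>s. indicator {..T} s * z s) \<in> borel_measurable lebesgue"
  proof -
    have "zp \<in> borel_measurable (lebesgue_on {..<0})"
      using L by (intro continuous_imp_measurable_on_sets_lebesgue lipschitz_on_continuous_on) auto
    then have "(\<lambda>s. indicator {..<0} s * zp s) \<in> borel_measurable lebesgue"
      by (simp add: borel_measurable_restrict_space_iff mult.commute)
    moreover have "(\<lambda>s. indicator {0..T} s * z s) \<in> borel_measurable lebesgue"
      using borel_measurable_integrable[OF zint]
      by (simp add: borel_measurable_restrict_space_iff mult.commute)
    \<comment> \<open>The Lipschitz past and the integrable part on \<open>{0..T}\<close> are glued
      at 0.\<close>
    moreover have "(\<lambda>s. indicator {..T} s * z s) =
        (\<lambda>s. indicator {..<0} s * zp s + indicator {0..T} s * z s)"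
      using T by (auto simp: indicator_def zzp fun_eq_iff)
    ultimately show ?thesis by simp
  qed
  define K where "K = M * (LINT s|lebesgue_on {0..T}. \<bar>z s\<bar>)
      + C * (LINT a|lebesgue_on {0..}. (1 + a)^2 * \<rho> a)"
  have past: "\<bar>z s\<bar> \<le> C * (1 + \<bar>s\<bar>)" if "s < 0" for s using that zpC zzp by simp
  note avg = delayed_average_bound[OF zmeas zint past C \<rho>meas assms(4) M assms(6)]
  \<comment> \<open>This is a pointwise estimate at every \<open>t\<close> where both the equation
    and the bound on \<open>f\<close> hold; \<open>K\<close> does not depend on
    \<open>t\<close>.\<close>
  have bound: "\<bar>z t\<bar> \<le> B + K"
    if t: "t \<in> {0<..<T}" and e: "(LINT a|lebesgue_on {0..}. (z t - z (t - a)) * \<rho> a) = f t"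
      and b: "\<bar>f t\<bar> \<le> B" for t
  proof -
    have t': "t \<in> {0..T}" using t by simp
    have "f t = (LINT a|lebesgue_on {0..}. z t * \<rho> a - z (t - a) * \<rho> a)"
      using e by (simp add: left_diff_distrib)
    \<comment> \<open>The unit mass of \<open>\<rho>\<close> isolates \<open>z t\<close>.\<close>
    also have "\<dots> = z t - (LINT a|lebesgue_on {0..}. z (t - a) * \<rho> a)"
      using \<rho>int avg(1)[OF _ _ _ t'] assms(5) by (subst Bochner_Integration.integral_diff) auto
    finally show ?thesis using avg(2)[OF _ _ _ t'] b unfolding K_def by fastforce
  qed
  have "AE t in lebesgue. t \<in> {0<..<T} \<longrightarrow> \<bar>z t\<bar> \<le> B + K"
  proof -
    \<comment> \<open>The two exceptional null sets belong to different restricted measures; both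
      are moved to the full line before they are combined.\<close>
    have "AE t in lebesgue. t \<in> {0<..} \<longrightarrow>
        (LINT a|lebesgue_on {0..}. (z t - z (t - a)) * \<rho> a) = f t"
      using eqn by (simp add: AE_restrict_space_iff)
    moreover have "AE t in lebesgue. t \<in> {0..} \<longrightarrow> \<bar>f t\<bar> \<le> B"
      using fB by (simp add: AE_restrict_space_iff)
    ultimately show ?thesis by eventually_elim (auto intro: bound)
  qed
  then have "AE t in lebesgue_on {0<..<T}. \<bar>z t\<bar> \<le> B + K"
    by (simp add: AE_restrict_space_iff)
  moreover have "z \<in> borel_measurable (lebesgue_on {0<..<T})"
    using borel_measurable_integrable[OF zint] by (rule measurable_restrict_mono) auto
  ultimately show "z \<in> Linfty {0<..<T}" by (auto simp: Linfty_def)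
qed

end
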